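(* Let $\Omega\subset\mathcal{F}$ be a disk, and let $(f_n)_{n\ge1}$ be maps $f_n:\Omega\to\mathcal{F}$ such that each $f_n$ is scaling with scaling ratio $q^{\lambda_n}$, $\lambda_n\in\mathbb{Z}$. Suppose (a) $q^{\lambda_n}\ge \operatorname{diam}(\Omega)^{-1}$ for all $n\ge1$; (b) $\sum_{N=1}^{\infty}\frac{\#K_N}{N^3}<\infty$, where $K_N=\{(n,m):1\le n,m\le N,\ \lambda_n=\lambda_m\}$. Then for Haar-almost every $x\in\Omega$, the sequence $([f_n(x)])_{n\ge1}$ is uniformly distributed in $\mathcal{O}$.
   Context: $\mathcal{F}$ is a non-Archimedean local field with valuation ring $\mathcal{O}$, maximal ideal $\mathfrak{p}$, $q=\#\mathcal{O}/\mathfrak{p}$, normalized absolute value $|\cdot|_\mathfrak{p}$ and prime element $\pi$. Fix representatives $C\subset\mathcal{O}$ of $\mathcal{O}/\mathfrak{p}$ with $0\in C$; writing $x=\sum_{n\ge v}c_n\pi^n$ ($c_n\in C$), the integral part is $[x]=\sum_{n\ge0}c_n\pi^n$. A disk is a set $D(a,q^k)=\{x:|x-a|_\mathfrak{p}\le q^k\}$, $k\in\mathbb{Z}$; its diameter is $q^k$. A map $f:\Omega\to\mathcal{F}$ is scaling with scaling ratio $q^\lambda$ ($\lambda\in\mathbb{Z}$) if $|f(x)-f(y)|_\mathfrak{p}=q^\lambda|x-y|_\mathfrak{p}$ for all $x,y\in\Omega$. Haar measure is normalized so $\mu(\mathcal{O})=1$. A sequence $(x_n)\subset\mathcal{O}$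 is uniformly distributed in $\mathcal{O}$ if for all $a\in\mathcal{O}$, $k\in\mathbb{N}$, $\frac1N\#\{1\le n\le N:x_n\in D(a,q^{-k})\}\to q^{-k}$. *)

theory Defs
  imports "HOL-Analysis.Analysis"
begin

text \<open>A non-Archimedean local field is modelled as a field type 'a together with
  a normalized discrete non-Archimedean absolute value av, the residue cardinality q,
  a prime element prm and a set C of representatives of O/p containing 0, such that
  'a is complete for av.\<close>

definition nonarch_local_field ::
  "('a::field \<Rightarrow> real) \<Rightarrow> nat \<Rightarrow> 'a \<Rightarrow> 'a set \<Rightarrow> bool" where
  "nonarch_local_field av q prm C \<longleftrightarrow>
     (\<forall>x. av x \<ge> 0) \<and> (\<forall>x. av x = 0 \<longleftrightarrow> x = 0) \<and>
     (\<forall>x y. av (x * y) = av x * av y) \<and>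
     (\<forall>x y. av (x + y) \<le> max (av x) (av y)) \<and>
     q \<ge> 2 \<and>
     (\<forall>x. x \<noteq> 0 \<longrightarrow> (\<exists>k::int. av x = real q powr k)) \<and>
     av prm = 1 / real q \<and>
     finite C \<and> card C = q \<and> 0 \<in> C \<and> (\<forall>c\<in>C. av c \<le> 1) \<and>
     (\<forall>x. av x \<le> 1 \<longrightarrow> (\<exists>!c\<in>C. av (x - c) < 1)) \<and>
     (\<forall>s::nat \<Rightarrow> 'a. (\<forall>e>0. \<exists>N. \<forall>m\<ge>N. \<forall>n\<ge>N. av (s m - s n) < e)
         \<longrightarrow> (\<exists>l. (\<lambda>n. av (s n - l)) \<longlonglongrightarrow> 0))"

definition disk :: "('a::field \<Rightarrow> real) \<Rightarrow> 'a \<Rightarrow> real \<Rightarrow> 'a set" where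
  "disk av a r = {x. av (x - a) \<le> r}"

text \<open>Haar measure normalized by mu(O) = 1: a translation-invariant measure on the
  sigma-algebra generated by the disks (= Borel sets), giving O measure 1.\<close>
definition haar_measure :: "('a::field \<Rightarrow> real) \<Rightarrow> nat \<Rightarrow> 'a measure \<Rightarrow> bool" where
  "haar_measure av q M \<longleftrightarrow>
     space M = UNIV \<and>
     sets M = sigma_sets UNIV {disk av a (real q powr k) | a k. True} \<and>
     (\<forall>a. \<forall>A\<in>sets M. emeasure M ((\<lambda>x. a + x) ` A) = emeasure M A) \<and>
     emeasure M (disk av 0 1) = 1"

text \<open>Integral part [x] = sum over n \<ge> 0 of c_n prm^n, i.e. x minus its finite
  polar part sum_{v \<le> n < 0} c_n prm^n with digits in C.\<close>
definition intpart :: "('a::field \<Rightarrow> real) \<Rightarrow> 'a \<Rightarrow> 'a set \<Rightarrow> 'a \<Rightarrow> 'a" where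
  "intpart av prm C x = (THE y. av y \<le> 1 \<and>
     (\<exists>k::nat. \<exists>c::nat \<Rightarrow> 'a. (\<forall>i<k. c i \<in> C) \<and>
        x - y = (\<Sum>i<k. c i * inverse prm ^ Suc i)))"

definition scaling :: "('a::field \<Rightarrow> real) \<Rightarrow> nat \<Rightarrow> 'a set \<Rightarrow> ('a \<Rightarrow> 'a) \<Rightarrow> int \<Rightarrow> bool" where
  "scaling av q \<Omega> f lam \<longleftrightarrow>
     (\<forall>x\<in>\<Omega>. \<forall>y\<in>\<Omega>. av (f x - f y) = real q powr lam * av (x - y))"

definition unif_distr :: "('a::field \<Rightarrow> real) \<Rightarrow> nat \<Rightarrow> (nat \<Rightarrow> 'a) \<Rightarrow> bool" where
  "unif_distr av q xs \<longleftrightarrow>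
     (\<forall>n\<ge>1. av (xs n) \<le> 1) \<and>
     (\<forall>a. av a \<le> 1 \<longrightarrow> (\<forall>k::nat.
        (\<lambda>N. real (card {n\<in>{1..N}. xs n \<in> disk av a (real q powr (- real k))}) / real N)
          \<longlonglongrightarrow> real q powr (- real k)))"

end

theory Submission
  imports Defs
begin

text \<open>Fix a residue disk \<open>D(c, q^-j)\<close> and let \<open>E_n\<close> be the set of \<open>x \<in> \<Omega>\<close> with
  \<open>[f_n(x)] \<in> D(c, q^-j)\<close>. A disk of radius \<open>q^-lam_n\<close> is mapped by \<open>f_n\<close> onto a unit disk, on which
  \<open>[.]\<close> is a translation, so \<open>E_n\<close> meets it in exactly one disk of radius \<open>q^(-lam_n - j)\<close>.
  Consequently \<open>E_n\<close> has relative measure \<open>q^-j\<close> in every disk of radius at least \<open>q^-lam_n\<close>, and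
  \<open>E_n\<close>, \<open>E_m\<close> are independent as soon as \<open>|lam_n - lam_m| \<ge> j\<close>. The variance of the number of
  visits up to time \<open>N\<close> is therefore at most a constant times \<open>#K_N\<close>, and the summability of
  \<open>#K_N / N^3\<close> gives almost sure convergence of the visit frequencies, as in the criterion of
  Davenport, Erdos and LeVeque.\<close>

subsection \<open>Averages of bounded sequences and counting pairs\<close>

text \<open>If \<open>|S N| \<ge> e N\<close>, then \<open>|S m| \<ge> e N / 2\<close> for all \<open>m\<close> in an interval of length \<open>e N / 2\<close>
  to the right of \<open>N\<close>, and these terms alone contribute a constant to the series.\<close>

lemma averages_tendsto_0:
  fixes y :: "nat \<Rightarrow> real"
  assumes bd: "\<And>n. \<bar>y n\<bar> \<le> 1"
    and summable: "summable (\<lambda>N. (\<Sum>n=1..N. y n)\<^sup>2 / real N ^ 3)"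
  shows "(\<lambda>N. (\<Sum>n=1..N. y n) / real N) \<longlonglongrightarrow> 0"
proof -
  define S where "S N = (\<Sum>n=1..N. y n)" for N
  have lip: "\<bar>S m - S N\<bar> \<le> real (m - N)" if "N \<le> m" for N m
  proof -
    have "{1..m} = {1..N} \<union> {N<..m}" using that by auto
    then have "S m = S N + (\<Sum>n\<in>{N<..m}. y n)" unfolding S_def
      by (simp add: sum.union_disjoint ivl_disj_int)
    moreover have "\<bar>\<Sum>n\<in>{N<..m}. y n\<bar> \<le> (\<Sum>n\<in>{N<..m}. 1)"
      by (rule order_trans[OF sum_abs]) (intro sum_mono bd)
    ultimately show ?thesis by simp
  qed
  have "\<forall>\<^sub>F N in sequentially. \<bar>S N / real N\<bar> < e" if e: "0 < e" "e \<le> 1" for e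
  proof -
    \<comment> \<open>The constant bounds the tail from below: more than \<open>e * N / 2\<close>
      terms, each at least \<open>(e * N / 2)^2 / (2 * N)^3 = e^2 / (32 * N)\<close>.\<close>
    from summable_Cauchy[THEN iffD1, OF summable] e obtain N0 where
      N0: "\<And>m n. m \<ge> N0 \<Longrightarrow> norm (\<Sum>N=m..<n. (S N)\<^sup>2 / real N ^ 3) < e ^ 3 / 64"
      unfolding S_def by (metis divide_pos_pos zero_less_numeral zero_less_power)
    have "\<bar>S N / real N\<bar> < e" if N: "N \<ge> max N0 1" for N
    proof (rule ccontr)
      assume "\<not> \<bar>S N / real N\<bar> < e"
      then have SN: "\<bar>S N\<bar> \<ge> e * real N" using N by (simp add: abs_divide field_simps)
      \<comment> \<open>The \<open>t + 1\<close> indices from \<open>N\<close> to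
        \<open>N + t\<close> exceed \<open>e * N / 2\<close> in number, while \<open>S\<close> moves
        by at most \<open>t \<le> e * N / 2\<close> on them.\<close>
      define t where "t = nat \<lfloor>e * real N / 2\<rfloor>"
      have "0 \<le> e * real N / 2" using e by simp
      then have t: "real t \<le> e * real N / 2" "e * real N / 2 < real t + 1"
        unfolding t_def by linarith+
      \<comment> \<open>Here \<open>e \<le> 1\<close> enters: the indices \<open>m\<close> stay at
        most \<open>2 * N\<close>, which bounds the denominators.\<close>
      have tN: "real t \<le> real N" using t(1) e mult_right_mono[of e 1 "real N"] by simp
      have "e ^ 3 / 64 \<le> (real t + 1) * (e\<^sup>2 * (real N)\<^sup>2 / 4 / (2 * real N) ^ 3)"
      proof -
        have "e ^ 3 / 64 = (e * real N / 2) * (e\<^sup>2 * (real N)\<^sup>2 / 4 / (2 * real N) ^ 3)"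
          using N by (simp add: field_simps power2_eq_square power3_eq_cube)
        also have "\<dots> \<le> (real t + 1) * (e\<^sup>2 * (real N)\<^sup>2 / 4 / (2 * real N) ^ 3)"
          using t by (intro mult_right_mono) auto
        finally show ?thesis .
      qed
      also have "\<dots> = (\<Sum>m=N..<N + t + 1. e\<^sup>2 * (real N)\<^sup>2 / 4 / (2 * real N) ^ 3)" by simp
      also have "\<dots> \<le> (\<Sum>m=N..<N + t + 1. (S m)\<^sup>2 / real m ^ 3)"
      proof (intro sum_mono frac_le)
        fix m assume m: "m \<in> {N..<N + t + 1}"
        then have "\<bar>S m - S N\<bar> \<le> real t" using lip[of N m] by auto
        then have "\<bar>S m\<bar> \<ge> e * real N / 2" using SN t by linarith
        then have "(e * real N / 2)\<^sup>2 \<le> (S m)\<^sup>2"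
          using power_mono[of "e * real N / 2" "\<bar>S m\<bar>" 2] e by simp
        then show "e\<^sup>2 * (real N)\<^sup>2 / 4 \<le> (S m)\<^sup>2" by (simp add: power_mult_distrib power_divide)
        show "real m ^ 3 \<le> (2 * real N) ^ 3" using m tN by (intro power_mono) auto
        show "0 < real m ^ 3" using m N by simp
      qed simp
      also have "\<dots> < e ^ 3 / 64"
        using N by (intro le_less_trans[OF abs_ge_self N0[unfolded real_norm_def]]) simp
      finally show False by simp
    qed
    then show ?thesis using eventually_sequentially by blast
  qed
  note small = this
  have "\<forall>\<^sub>F N in sequentially. \<bar>S N / real N\<bar> < e" if "0 < e" for e
    using small[of "min e 1"] that by (auto elim!: eventually_mono)
  then show ?thesis unfolding S_def[symmetric] tendsto_iff dist_real_def by simp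
qed

text \<open>With \<open>c l\<close> the number of indices of exponent \<open>l\<close>, the two
  cardinalities are the autocorrelations of \<open>c\<close> at shifts \<open>i\<close> and 0. The
  one at 0 is maximal by \<open>2 * u * v \<le> u^2 + v^2\<close> and translation of the summation
  index.\<close>

lemma card_shifted_pairs_le:
  fixes lam :: "'b \<Rightarrow> int"
  assumes "finite A"
  shows "card {(n, m). n \<in> A \<and> m \<in> A \<and> lam n = lam m + i} \<le> card {(n, m). n \<in> A \<and> m \<in> A \<and> lam n = lam m}"
proof -
  define c where "c l = card {n \<in> A. lam n = l}" for l
  have count: "card {(n, m). n \<in> A \<and> m \<in> A \<and> lam n = lam m + i} = (\<Sum>l\<in>lam ` A. c (l + i) * c l)" for i
  proof -
    have "{(n, m). n \<in> A \<and> m \<in> A \<and> lam n = lam m + i}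
        = (\<Union>l\<in>lam ` A. {n \<in> A. lam n = l + i} \<times> {m \<in> A. lam m = l})" by auto
    also have "card \<dots> = (\<Sum>l\<in>lam ` A. card ({n \<in> A. lam n = l + i} \<times> {m \<in> A. lam m = l}))"
      using assms by (intro card_UN_disjoint) auto
    finally show ?thesis by (simp add: card_cartesian_product c_def)
  qed
  have "(\<Sum>l\<in>lam ` A. c (l + i) * c (l + i)) = (\<Sum>l\<in>(\<lambda>l. l + i) ` lam ` A. c l * c l)"
    by (subst sum.reindex) (auto simp: inj_on_def)
  also have "\<dots> = (\<Sum>l\<in>(\<lambda>l. l + i) ` lam ` A \<inter> lam ` A. c l * c l)"
  proof (intro sum.mono_neutral_right ballI)
    fix l assume "l \<in> (\<lambda>l. l + i) ` lam ` A - (\<lambda>l. l + i) ` lam ` A \<inter> lam ` A"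
    then have "l \<notin> lam ` A" by blast
    then have "{n \<in> A. lam n = l} = {}" by blast
    then show "c l * c l = 0" by (simp only: c_def card.empty)
  qed (use assms in auto)
  also have "\<dots> \<le> (\<Sum>l\<in>lam ` A. c l * c l)"
    using assms by (intro sum_mono2) auto
  finally have shift: "(\<Sum>l\<in>lam ` A. c (l + i) * c (l + i)) \<le> (\<Sum>l\<in>lam ` A. c l * c l)" .
  have amgm: "2 * (u * v) \<le> u * u + v * v" for u v :: nat
    using nat_le_linear[of u v] by (auto simp: le_iff_add algebra_simps)
  have "2 * (\<Sum>l\<in>lam ` A. c (l + i) * c l) \<le> (\<Sum>l\<in>lam ` A. c (l + i) * c (l + i) + c l * c l)"
    unfolding sum_distrib_left by (intro sum_mono amgm)
  then have "(\<Sum>l\<in>lam ` A. c (l + i) * c l) \<le> (\<Sum>l\<in>lam ` A. c l * c l)"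
    using shift by (simp add: sum.distrib)
  then show ?thesis using count[of i] count[of 0] by simp
qed

text \<open>A union bound over the differences of exponents. The range
  \<open>{- int j..<int j}\<close> covers all of them and has exactly \<open>2 * j\<close> elements,
  also for \<open>j = 0\<close>.\<close>

lemma card_near_pairs_le:
  fixes lam :: "'b \<Rightarrow> int"
  assumes "finite A"
  shows "card {(n, m). n \<in> A \<and> m \<in> A \<and> \<bar>lam n - lam m\<bar> < int j}
    \<le> 2 * j * card {(n, m). n \<in> A \<and> m \<in> A \<and> lam n = lam m}"
proof -
  have "{(n, m). n \<in> A \<and> m \<in> A \<and> \<bar>lam n - lam m\<bar> < int j}
      \<subseteq> (\<Union>i\<in>{- int j..<int j}. {(n, m). n \<in> A \<and> m \<in> A \<and> lam n = lam m + i})"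
  proof clarify
    fix n m assume "n \<in> A" "m \<in> A" "\<bar>lam n - lam m\<bar> < int j"
    then show "(n, m) \<in> (\<Union>i\<in>{- int j..<int j}. {(n, m). n \<in> A \<and> m \<in> A \<and> lam n = lam m + i})"
      by (intro UN_I[of "lam n - lam m"]) auto
  qed
  moreover have fin: "finite {(n, m). n \<in> A \<and> m \<in> A \<and> P n m}" for P
    by (rule finite_subset[of _ "A \<times> A"]) (use assms in auto)
  ultimately have "card {(n, m). n \<in> A \<and> m \<in> A \<and> \<bar>lam n - lam m\<bar> < int j}
      \<le> card (\<Union>i\<in>{- int j..<int j}. {(n, m). n \<in> A \<and> m \<in> A \<and> lam n = lam m + i})"
    by (intro card_mono finite_UN_I) auto
  also have "\<dots> \<le> (\<Sum>i\<in>{- int j..<int j}. card {(n, m). n \<in> A \<and> m \<in> A \<and> lam n = lam m + i})"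
    by (intro card_UN_le) auto
  also have "\<dots> \<le> (\<Sum>i\<in>{- int j..<int j}. card {(n, m). n \<in> A \<and> m \<in> A \<and> lam n = lam m})"
    by (intro sum_mono card_shifted_pairs_le assms)
  finally show ?thesis by (simp add: nat_mult_distrib)
qed

subsection \<open>Disks and integral parts\<close>

locale local_field =
  fixes av :: "'a::field \<Rightarrow> real" and q :: nat and prm :: 'a and C :: "'a set"
  assumes local_field: "nonarch_local_field av q prm C"
begin

section \<open>The absolute value\<close>

lemma av_nonneg [simp]: "av x \<ge> 0"
  and av_eq_0_iff [simp]: "av x = 0 \<longleftrightarrow> x = 0"
  and av_mult: "av (x * y) = av x * av y"
  and av_add_le: "av (x + y) \<le> max (av x) (av y)"
  and q_ge_2: "q \<ge> 2"
  and av_value: "x \<noteq> 0 \<Longrightarrow> \<exists>k::int. av x = real q powr k"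
  and av_prm: "av prm = 1 / real q"
  and finite_C: "finite C"
  and card_C: "card C = q"
  and zero_in_C: "0 \<in> C"
  and av_C: "c \<in> C \<Longrightarrow> av c \<le> 1"
  and digit_unique: "av x \<le> 1 \<Longrightarrow> \<exists>!c\<in>C. av (x - c) < 1"
proof -
  have "\<forall>x. av x \<ge> 0" "\<forall>x. av x = 0 \<longleftrightarrow> x = 0" "\<forall>x y. av (x * y) = av x * av y"
    "\<forall>x y. av (x + y) \<le> max (av x) (av y)" "\<forall>x. x \<noteq> 0 \<longrightarrow> (\<exists>k::int. av x = real q powr k)"
    "\<forall>c\<in>C. av c \<le> 1" "\<forall>x. av x \<le> 1 \<longrightarrow> (\<exists>!c\<in>C. av (x - c) < 1)"
    and *: "q \<ge> 2" "av prm = 1 / real q" "finite C" "card C = q" "0 \<in> C"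
    using local_field[unfolded nonarch_local_field_def] by - (elim conjE, assumption)+
  then show "av x \<ge> 0" "av x = 0 \<longleftrightarrow> x = 0" "av (x * y) = av x * av y"
    "av (x + y) \<le> max (av x) (av y)" "x \<noteq> 0 \<Longrightarrow> \<exists>k::int. av x = real q powr k"
    "c \<in> C \<Longrightarrow> av c \<le> 1" "av x \<le> 1 \<Longrightarrow> \<exists>!c\<in>C. av (x - c) < 1"
    by simp_all
  show "q \<ge> 2" "av prm = 1 / real q" "finite C" "card C = q" "0 \<in> C" by (fact *)+
qed

lemma q_gt_1: "real q > 1"
  using q_ge_2 by simp

lemma av_0 [simp]: "av 0 = 0"
  using av_eq_0_iff[of 0] by blast

lemma av_1 [simp]: "av 1 = 1"
  using av_mult[of 1 1] av_eq_0_iff[of 1] by simp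

lemma av_minus [simp]: "av (- x) = av x"
proof -
  have "av (-1) * av (-1) = 1" using av_mult[of "-1" "-1"] by simp
  then have "av (-1) = 1"
    using av_nonneg[of "-1"] by (metis abs_of_nonneg abs_mult_self_eq mult_1 real_sqrt_abs2 real_sqrt_one)
  then show ?thesis using av_mult[of "-1" x] by simp
qed

lemma av_minus_commute: "av (x - y) = av (y - x)"
  using av_minus[of "x - y"] by simp

lemma av_add_leI: "av x \<le> r \<Longrightarrow> av y \<le> r \<Longrightarrow> av (x + y) \<le> r"
  using av_add_le[of x y] by simp

lemma av_diff_leI: "av x \<le> r \<Longrightarrow> av y \<le> r \<Longrightarrow> av (x - y) \<le> r"
  using av_add_leI[of x r "- y"] by simp

lemma av_triangle: "av (x - y) \<le> r \<Longrightarrow> av (y - z) \<le> r \<Longrightarrow> av (x - z) \<le> r"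
  using av_add_leI[of "x - y" r "y - z"] by simp

lemma av_inverse: "av (inverse x) = inverse (av x)"
proof (cases "x = 0")
  case False
  then have "av x * av (inverse x) = 1" by (simp flip: av_mult)
  then show ?thesis by (metis inverse_unique)
qed simp

lemma av_power: "av (x ^ n) = av x ^ n"
  by (induction n) (auto simp: av_mult)

lemma av_power_int: "av (x powi n) = av x powi n"
  by (simp add: power_int_def av_power av_inverse)

lemma prm_nonzero: "prm \<noteq> 0"
  using av_prm q_ge_2 av_eq_0_iff[of prm] by auto

lemma av_prm_powi: "av (prm powi n) = real q powr of_int (- n)"
proof -
  have "av (prm powi n) = inverse (real q) powi n"
    by (simp add: av_power_int av_prm inverse_eq_divide)
  also have "\<dots> = real q powr of_int (- n)"
    using q_gt_1
    by (simp add: power_int_inverse powr_minus powr_real_of_int')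
  finally show ?thesis .
qed

text \<open>The value group is discrete: nonzero values are integral powers of \<open>q\<close>, so
  a strict inequality gains a whole factor \<open>q\<close>.\<close>

lemma av_less_imp_le:
  assumes "av x < real q powr of_int l"
  shows "av x \<le> real q powr of_int (l - 1)"
proof (cases "x = 0")
  case False
  then obtain m :: int where m: "av x = real q powr of_int m" using av_value by blast
  then have "m < l" using assms q_gt_1 by simp
  then show ?thesis using m q_gt_1 by simp
qed simp

lemma C_eqI:
  assumes "c \<in> C" "d \<in> C" "av (c - d) < 1"
  shows "c = d"
  using digit_unique[OF av_C[OF assms(1)]] assms
  by (metis av_0 diff_self zero_less_one)

section \<open>Disks and their subdivision\<close>

definition D :: "'a \<Rightarrow> int \<Rightarrow> 'a set" where
  "D b l = disk av b (real q powr of_int l)"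

lemma in_D: "x \<in> D b l \<longleftrightarrow> av (x - b) \<le> real q powr of_int l"
  by (simp add: D_def disk_def)

lemma center_in_D [simp]: "b \<in> D b l"
  by (simp add: in_D)

lemma D_eq: "x \<in> D b l \<Longrightarrow> D x l = D b l"
  unfolding in_D set_eq_iff using av_triangle av_minus_commute by metis

lemma D_mono: "l \<le> m \<Longrightarrow> D b l \<subseteq> D b m"
  unfolding in_D subset_iff using powr_mono[of "of_int l" "of_int m" "real q"] q_gt_1
  by (meson less_imp_le of_int_le_iff order_trans)

lemma D_subset: "x \<in> D b m \<Longrightarrow> l \<le> m \<Longrightarrow> D x l \<subseteq> D b m"
  using D_mono[of l m x] D_eq[of x b m] by simp

text \<open>Centre of one of the \<open>q\<close> subdisks of \<open>D b l\<close> of the next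
  smaller radius: \<open>prm powi (- l)\<close> has absolute value \<open>q^l\<close>, so
  \<open>c\<close> acts as the digit at the scale of the disk.\<close>

definition child :: "'a \<Rightarrow> int \<Rightarrow> 'a \<Rightarrow> 'a" where
  "child b l c = b + c * prm powi (- l)"

lemma av_child_diff: "av (child b l c - child b l d) = real q powr of_int l * av (c - d)"
proof -
  have "child b l c - child b l d = (c - d) * prm powi (- l)"
    by (simp add: child_def algebra_simps)
  then show ?thesis by (simp add: av_mult av_prm_powi)
qed

lemma child_in_D:
  assumes "c \<in> C"
  shows "child b l c \<in> D b l"
proof -
  have "child b l c - b = c * prm powi (- l)" by (simp add: child_def)
  then show ?thesis using av_C[OF assms] by (simp add: in_D av_mult av_prm_powi mult_left_le_one_le)
qed

text \<open>Multiplication by \<open>prm powi l\<close> moves \<open>x - b\<close> into the unit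
  disk, where its residue digit picks the child. Discreteness turns the strict inequality into
  radius \<open>q^(l-1)\<close>.\<close>

lemma D_split: "D b l = (\<Union>c\<in>C. D (child b l c) (l - 1))"
proof (intro equalityI subsetI)
  fix x assume x: "x \<in> D b l"
  let ?z = "(x - b) * prm powi l"
  have "av ?z = av (x - b) * real q powr of_int (- l)" by (simp add: av_mult av_prm_powi)
  also have "\<dots> \<le> real q powr of_int l * real q powr of_int (- l)"
    using x by (intro mult_right_mono) (auto simp: in_D)
  also have "\<dots> = 1" using q_gt_1 by (simp flip: powr_add)
  finally obtain c where c: "c \<in> C" "av (?z - c) < 1" using digit_unique by blast
  have "x - child b l c = (?z - c) * prm powi (- l)"
    using prm_nonzero by (simp add: child_def power_int_minus field_simps)
  then have "av (x - child b l c) = av (?z - c) * real q powr of_int l"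
    by (simp add: av_mult av_prm_powi)
  also have "\<dots> < real q powr of_int l" using c q_gt_1 by simp
  finally have "x \<in> D (child b l c) (l - 1)" unfolding in_D by (rule av_less_imp_le)
  then show "x \<in> (\<Union>c\<in>C. D (child b l c) (l - 1))" using c by blast
next
  fix x assume "x \<in> (\<Union>c\<in>C. D (child b l c) (l - 1))"
  then show "x \<in> D b l" using D_subset[OF child_in_D, of _ "l - 1" l b] by auto
qed

text \<open>A common point would put the two centres within \<open>q^(l-1)\<close> of each other,
  whereas distinct digits put them at distance \<open>q^l\<close>.\<close>

lemma disjoint_children: "disjoint_family_on (\<lambda>c. D (child b l c) (l - 1)) C"
proof (unfold disjoint_family_on_def, intro ballI impI, rule ccontr)
  fix c d assume cd: "c \<in> C" "d \<in> C" "c \<noteq> d"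
  assume "D (child b l c) (l - 1) \<inter> D (child b l d) (l - 1) \<noteq> {}"
  then obtain x where "x \<in> D (child b l c) (l - 1)" "x \<in> D (child b l d) (l - 1)" by blast
  then have "av (child b l c - child b l d) \<le> real q powr of_int (l - 1)"
    unfolding in_D using av_triangle av_minus_commute by metis
  also have "\<dots> < real q powr of_int l" using q_gt_1 by simp
  finally have "av (c - d) < 1" unfolding av_child_diff using q_gt_1 by simp
  then show False using C_eqI cd by blast
qed

text \<open>Splitting the unit disk \<open>j\<close> times leaves finitely many disks. Uniform
  distribution can then be tested on countably many disks, as an almost everywhere statement
  requires.\<close>

lemma finite_net: "\<exists>R. finite R \<and> R \<subseteq> D 0 0 \<and> (\<forall>x\<in>D 0 0. \<exists>b\<in>R. x \<in> D b (- int j))"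
proof (induction j)
  case 0
  then show ?case by (intro exI[of _ "{0}"]) auto
next
  case (Suc j)
  then obtain R where R: "finite R" "R \<subseteq> D 0 0" "\<And>x. x \<in> D 0 0 \<Longrightarrow> \<exists>b\<in>R. x \<in> D b (- int j)" by blast
  let ?R = "(\<lambda>(b, c). child b (- int j) c) ` (R \<times> C)"
  show ?case
  proof (intro exI[of _ ?R] conjI ballI)
    show "finite ?R" using R finite_C by simp
    show "?R \<subseteq> D 0 0"
    proof clarify
      fix b c assume "b \<in> R" "c \<in> C"
      then show "child b (- int j) c \<in> D 0 0"
        using child_in_D[of c b "- int j"] D_subset[of b 0 0 "- int j"] R(2) by auto
    qed
    fix x assume "x \<in> D 0 0"
    then obtain b where b: "b \<in> R" "x \<in> D b (- int j)" using R by blast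
    then obtain c where c: "c \<in> C" "x \<in> D (child b (- int j) c) (- int j - 1)" using D_split by blast
    moreover have "- int j - 1 = - int (Suc j)" by simp
    ultimately show "\<exists>b\<in>?R. x \<in> D b (- int (Suc j))" using b by force
  qed
qed

text \<open>Pigeonhole: the images of the \<open>q\<close> children of a disk lie in pairwise different children of
  the image disk, so none of these is missed.\<close>

lemma scaling_approx_step:
  assumes f: "scaling av q \<Omega> f lam" and sub: "D b s \<subseteq> \<Omega>" and y: "av (f b - y) \<le> real q powr of_int (s + lam)"
  shows "\<exists>x\<in>D b s. av (f x - y) \<le> real q powr of_int (s - 1 + lam)"
proof -
  \<comment> \<open>\<open>?z c\<close> rescales \<open>f (?x c) - y\<close> to the unit disk. Its
    digit \<open>g c\<close> below tells in which child of the disk around \<open>y\<close> the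
    image lies; digit 0 means the child centred at \<open>y\<close>.\<close>
  let ?x = "child b s" let ?z = "\<lambda>c. (f (?x c) - y) * prm powi (s + lam)"
  have scal: "av (f u - f v) = real q powr of_int lam * av (u - v)" if "u \<in> D b s" "v \<in> D b s" for u v
    using f sub that unfolding scaling_def by blast
  have x: "?x c \<in> D b s" if "c \<in> C" for c using child_in_D that .
  have z1: "av (?z c) \<le> 1" if "c \<in> C" for c
  proof -
    have "av (f (?x c) - f b) \<le> real q powr of_int (s + lam)"
      using scal[OF x[OF that] center_in_D] x[OF that] q_gt_1 by (simp add: in_D powr_add mult.commute)
    then have "av (f (?x c) - y) \<le> real q powr of_int (s + lam)" using y av_triangle by blast
    then have "av (?z c) \<le> real q powr of_int (s + lam) * real q powr of_int (- (s + lam))"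
      unfolding av_mult av_prm_powi by (intro mult_right_mono) auto
    then show ?thesis using q_gt_1 by (simp flip: powr_add)
  qed
  \<comment> \<open>The scaling ratio and the radius cancel, so the images of distinct children have
    distinct digits.\<close>
  have z_diff: "av (?z c - ?z d) = av (c - d)" if "c \<in> C" "d \<in> C" for c d
  proof -
    have "?z c - ?z d = (f (?x c) - f (?x d)) * prm powi (s + lam)" by (simp add: algebra_simps)
    then have "av (?z c - ?z d) = real q powr of_int lam * (real q powr of_int s * av (c - d))
        * real q powr of_int (- (s + lam))"
      using scal[OF x x, OF that] by (simp add: av_mult av_prm_powi av_child_diff)
    also have "\<dots> = av (c - d) * (real q powr of_int lam * real q powr of_int s
        * real q powr of_int (- (s + lam)))" by (simp only: ac_simps)
    also have "\<dots> = av (c - d)" using q_gt_1 by (simp flip: powr_add)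
    finally show ?thesis .
  qed
  obtain g where g: "\<And>c. c \<in> C \<Longrightarrow> g c \<in> C \<and> av (?z c - g c) < 1"
    using digit_unique[OF z1] by metis
  have "inj_on g C"
  proof (rule inj_onI)
    fix c d assume cd: "c \<in> C" "d \<in> C" "g c = g d"
    have "?z c - ?z d = (?z c - g c) + - (?z d - g d)" using cd by simp
    then have "av (?z c - ?z d) \<le> max (av (?z c - g c)) (av (?z d - g d))"
      using av_add_le[of "?z c - g c" "- (?z d - g d)"] by (simp only: av_minus)
    also have "\<dots> < 1" using g[OF cd(1)] g[OF cd(2)] unfolding cd(3) by simp
    finally show "c = d" using z_diff cd C_eqI by auto
  qed
  \<comment> \<open>An injective self-map of the finite set \<open>C\<close> is onto, so some child
    has digit 0.\<close>
  then have "g ` C = C" using g finite_C by (intro endo_inj_surj) auto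
  then obtain c where c: "c \<in> C" "g c = 0" using zero_in_C by (metis imageE)
  then have "av (?z c) < 1" using g[of c] by simp
  then have "av (f (?x c) - y) * real q powr of_int (- (s + lam)) < 1" by (simp only: av_mult av_prm_powi)
  then have "av (f (?x c) - y) < real q powr of_int (s + lam)"
    using q_gt_1 by (simp add: powr_minus field_simps del: of_int_add minus_add_distrib)
  then have "av (f (?x c) - y) \<le> real q powr of_int (s + lam - 1)" by (rule av_less_imp_le)
  then show ?thesis using x c by (intro bexI[of _ "?x c"]) (auto simp: algebra_simps)
qed

text \<open>The previous step is repeated inside the smaller disk around the point just found.
  Approximation to a finite precision is what the preimage of a disk calls for.\<close>

lemma scaling_approx:
  assumes f: "scaling av q \<Omega> f lam" and sub: "D b s \<subseteq> \<Omega>" and y: "av (f b - y) \<le> real q powr of_int (s + lam)"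
  shows "\<exists>x\<in>D b s. av (f x - y) \<le> real q powr of_int (s - int j + lam)"
proof (induction j)
  case 0
  then show ?case using y by auto
next
  case (Suc j)
  then obtain x where x: "x \<in> D b s" "av (f x - y) \<le> real q powr of_int (s - int j + lam)" by blast
  have "D x (s - int j) \<subseteq> D b s" by (rule D_subset[OF x(1)]) simp
  with scaling_approx_step[OF f _ x(2)] sub show ?case by (auto simp: algebra_simps)
qed

section \<open>Polar and integral parts\<close>

text \<open>Candidates for \<open>x - [x]\<close>. Since 0 is a digit, \<open>n\<close> is only an
  upper bound for the pole order, which lets two candidates be compared at a common length.\<close>

definition polar :: "nat \<Rightarrow> 'a \<Rightarrow> bool" where
  "polar n r \<longleftrightarrow> (\<exists>c. (\<forall>i<n. c i \<in> C) \<and> r = (\<Sum>i<n. c i * inverse prm ^ Suc i))"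

lemma av_inverse_prm_power: "av (inverse prm ^ n) = real q ^ n"
  by (simp add: av_power av_inverse av_prm)

lemma polar_0: "polar 0 r \<longleftrightarrow> r = 0"
  by (simp add: polar_def)

lemma polar_Suc: "polar (Suc n) r \<longleftrightarrow> (\<exists>c\<in>C. polar n (r - c * inverse prm ^ Suc n))"
proof
  assume "polar (Suc n) r"
  then obtain c where c: "\<forall>i<Suc n. c i \<in> C" "r = (\<Sum>i<Suc n. c i * inverse prm ^ Suc i)"
    unfolding polar_def by blast
  then show "\<exists>c\<in>C. polar n (r - c * inverse prm ^ Suc n)"
    by (intro bexI[of _ "c n"]) (auto simp: polar_def intro!: exI[of _ c])
next
  assume "\<exists>c\<in>C. polar n (r - c * inverse prm ^ Suc n)"
  then obtain d c where dc: "d \<in> C" "\<forall>i<n. c i \<in> C"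
    "r - d * inverse prm ^ Suc n = (\<Sum>i<n. c i * inverse prm ^ Suc i)"
    unfolding polar_def by blast
  then show "polar (Suc n) r" unfolding polar_def
    by (intro exI[of _ "c(n := d)"]) (auto simp: less_Suc_eq algebra_simps)
qed

lemma polar_mono:
  assumes "polar n r" "n \<le> m"
  shows "polar m r"
  using assms(2,1)
proof (induction m rule: dec_induct)
  case (step m)
  then show ?case unfolding polar_Suc using zero_in_C by (intro bexI[of _ 0]) auto
qed

lemma av_polar_le: "polar n r \<Longrightarrow> av r \<le> real q ^ n"
proof (induction n arbitrary: r)
  case 0
  then show ?case by (simp add: polar_0)
next
  case (Suc n)
  then obtain c where c: "c \<in> C" "polar n (r - c * inverse prm ^ Suc n)" unfolding polar_Suc by blast
  have "av (c * inverse prm ^ Suc n) \<le> real q ^ Suc n"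
    unfolding av_mult av_inverse_prm_power using av_C c by (simp add: mult_left_le_one_le)
  moreover have "av (r - c * inverse prm ^ Suc n) \<le> real q ^ Suc n"
    using Suc.IH[OF c(2)] q_gt_1 by (meson lessI less_imp_le order_trans power_increasing)
  ultimately show ?case using av_add_leI by fastforce
qed

text \<open>Induction from the highest pole order: if the leading digits differed, their terms would
  differ by \<open>q^(n+1)\<close> in absolute value, but \<open>r - s\<close> and the lower parts
  are bounded by \<open>q^n\<close>.\<close>

lemma polar_unique:
  assumes "polar n r" "polar n s" "av (r - s) \<le> 1"
  shows "r = s"
  using assms
proof (induction n arbitrary: r s)
  case 0
  then show ?case by (simp add: polar_0)
next
  case (Suc n)
  let ?P = "inverse prm ^ Suc n"
  obtain c d where c: "c \<in> C" "polar n (r - c * ?P)" and d: "d \<in> C" "polar n (s - d * ?P)"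
    using Suc.prems unfolding polar_Suc by blast
  have "av ((r - c * ?P) - (s - d * ?P)) \<le> real q ^ n"
    by (rule av_diff_leI[OF av_polar_le[OF c(2)] av_polar_le[OF d(2)]])
  moreover have "av (r - s) \<le> real q ^ n" using Suc.prems(3) q_gt_1 by (simp add: order_trans[OF _ one_le_power])
  ultimately have "av ((r - s) - ((r - c * ?P) - (s - d * ?P))) \<le> real q ^ n"
    by (rule av_diff_leI[rotated])
  also have "(r - s) - ((r - c * ?P) - (s - d * ?P)) = (c - d) * ?P" by (simp only: algebra_simps)
  finally have "av (c - d) * (real q ^ Suc n) \<le> real q ^ n" unfolding av_mult av_inverse_prm_power .
  then have "(av (c - d) * real q) * real q ^ n \<le> 1 * real q ^ n" by (simp add: ac_simps)
  then have "av (c - d) * real q \<le> 1" by (rule mult_right_le_imp_le) (use q_gt_1 in simp)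
  then have "av (c - d) < 1" using q_gt_1
    by (smt (verit) av_nonneg mult_le_cancel_right1)
  then have "c = d" using C_eqI c d by blast
  then show ?case using Suc.IH[OF c(2) d(2)] Suc.prems(3) by simp
qed

lemma polar_exists:
  assumes "av x \<le> real q ^ n"
  shows "\<exists>r. polar n r \<and> av (x - r) \<le> 1"
  using assms
proof (induction n arbitrary: x)
  case 0
  then show ?case by (intro exI[of _ 0]) (auto simp: polar_0)
next
  case (Suc n)
  have "x \<in> D 0 (int (Suc n))" using Suc.prems q_gt_1 unfolding in_D
    by (simp only: of_int_of_nat_eq powr_realpow) (simp add: powr_realpow)
  then obtain c where c: "c \<in> C" "x \<in> D (child 0 (int (Suc n)) c) (int (Suc n) - 1)"
    using D_split by blast
  moreover have "prm powi (- int (Suc n)) = inverse prm ^ Suc n"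
    by (simp only: power_int_minus power_int_of_nat power_inverse)
  ultimately have "av (x - c * inverse prm ^ Suc n) \<le> real q ^ n"
    using q_gt_1 by (simp add: in_D child_def powr_realpow)
  then obtain r where "polar n r" "av (x - c * inverse prm ^ Suc n - r) \<le> 1" using Suc.IH by blast
  then show ?case unfolding polar_Suc using c(1)
    by (intro exI[of _ "r + c * inverse prm ^ Suc n"] conjI bexI[of _ c]) (simp_all add: algebra_simps)
qed

text \<open>This evaluates the definite description in \<open>intpart\<close>: a competing polar
  part, padded to length \<open>max n m\<close>, differs from \<open>r\<close> by an integral
  element and hence equals \<open>r\<close>.\<close>

lemma intpart_eq:
  assumes "polar n r" "av (x - r) \<le> 1"
  shows "intpart av prm C x = x - r"
proof -
  have "intpart av prm C x = (THE y. av y \<le> 1 \<and> (\<exists>n. polar n (x - y)))"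
    by (simp add: intpart_def polar_def)
  also have "\<dots> = x - r"
  proof (rule the_equality)
    fix y assume "av y \<le> 1 \<and> (\<exists>n. polar n (x - y))"
    then obtain m where y: "av y \<le> 1" "polar m (x - y)" by blast
    have "polar (max n m) r" "polar (max n m) (x - y)" using assms y polar_mono by auto
    moreover have "av (r - (x - y)) \<le> 1" using av_diff_leI[OF y(1) assms(2)] by (simp add: algebra_simps)
    ultimately show "y = x - r" using polar_unique by fastforce
  qed (use assms in auto)
  finally show ?thesis .
qed

lemma polar_part: "\<exists>n r. polar n r \<and> av (x - r) \<le> 1"
proof -
  obtain n where "av x < real q ^ n" using real_arch_pow q_gt_1 by blast
  then show ?thesis using polar_exists[of x n] by auto
qed

lemma av_intpart_le: "av (intpart av prm C x) \<le> 1"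
  using polar_part[of x] intpart_eq by metis

text \<open>On a disk of radius \<open>q^-lam\<close> the image has diameter at most 1, so all
  values of \<open>f\<close> there share the polar part \<open>r\<close> of \<open>f b\<close>. The
  condition then says that \<open>f u\<close> is within \<open>q^-j\<close> of \<open>c + r\<close>,
  and scaling pulls this back to a disk about an approximate preimage of
  \<open>c + r\<close>.\<close>

lemma intpart_scaling_preimage:
  assumes f: "scaling av q \<Omega> f lam" and sub: "D b (- lam) \<subseteq> \<Omega>" and c: "av c \<le> 1"
  shows "\<exists>x\<in>D b (- lam). {u \<in> D b (- lam). intpart av prm C (f u) \<in> D c (- int j)} = D x (- lam - int j)"
proof -
  have scal: "av (f u - f v) = real q powr of_int lam * av (u - v)" if "u \<in> D b (- lam)" "v \<in> D b (- lam)" for u v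
    using f sub that unfolding scaling_def by blast
  obtain n r where r: "polar n r" "av (f b - r) \<le> 1" using polar_part by blast
  have ip: "intpart av prm C (f u) = f u - r" if u: "u \<in> D b (- lam)" for u
  proof -
    have "av (f u - f b) \<le> real q powr of_int lam * real q powr of_int (- lam)"
      unfolding scal[OF u center_in_D] using u by (intro mult_left_mono) (auto simp: in_D)
    also have "\<dots> = 1" using q_gt_1 by (simp flip: powr_add)
    finally show ?thesis using intpart_eq r av_triangle by blast
  qed
  have "av (f b - (c + r)) \<le> real q powr of_int (- lam + lam)"
    using av_diff_leI[OF r(2) c] q_gt_1 by (simp add: algebra_simps)
  from scaling_approx[OF f sub this, of j] obtain x where
    x: "x \<in> D b (- lam)" "av (f x - (c + r)) \<le> real q powr of_int (- int j)"
    by (auto simp: algebra_simps)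
  have "u \<in> D x (- lam - int j) \<longleftrightarrow> intpart av prm C (f u) \<in> D c (- int j)" if u: "u \<in> D b (- lam)" for u
  proof -
    have "u \<in> D x (- lam - int j) \<longleftrightarrow> real q powr of_int lam * av (u - x) \<le> real q powr of_int lam * real q powr of_int (- lam - int j)"
      using q_gt_1 unfolding in_D by (subst mult_le_cancel_left_pos) auto
    also have "\<dots> \<longleftrightarrow> av (f u - f x) \<le> real q powr of_int (- int j)"
      using scal[OF u x(1)] by (simp flip: powr_add)
    \<comment> \<open>Every point of a disk is a centre of it, so \<open>c + r\<close> may replace
      \<open>f x\<close>.\<close>
    also have "\<dots> \<longleftrightarrow> av (f u - (c + r)) \<le> real q powr of_int (- int j)"
      using x(2) av_triangle av_minus_commute by metis
    also have "\<dots> \<longleftrightarrow> intpart av prm C (f u) \<in> D c (- int j)"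
      unfolding ip[OF u] in_D by (simp add: algebra_simps)
    finally show ?thesis .
  qed
  moreover have "D x (- lam - int j) \<subseteq> D b (- lam)" using D_subset x by simp
  ultimately show ?thesis using x(1) by (intro bexI[of _ x]) auto
qed

end

subsection \<open>Haar measure of the preimages\<close>

locale local_field_haar = local_field +
  fixes M :: "'a measure"
  assumes haar: "haar_measure av q M"
begin

section \<open>Measure of disks\<close>

lemma D_sets [measurable]: "D b l \<in> sets M"
  using haar unfolding haar_measure_def D_def by (auto intro!: sigma_sets.Basic)

lemma emeasure_unit: "emeasure M (disk av 0 1) = 1"
  and emeasure_translate: "A \<in> sets M \<Longrightarrow> emeasure M ((\<lambda>x. a + x) ` A) = emeasure M A"
proof -
  have "emeasure M (disk av 0 1) = 1"
    and "\<forall>a. \<forall>A\<in>sets M. emeasure M ((\<lambda>x. a + x) ` A) = emeasure M A"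
    using haar[unfolded haar_measure_def] by - (elim conjE, assumption)+
  then show "emeasure M (disk av 0 1) = 1"
    and "A \<in> sets M \<Longrightarrow> emeasure M ((\<lambda>x. a + x) ` A) = emeasure M A" by simp_all
qed

lemma emeasure_D_translate: "emeasure M (D b l) = emeasure M (D 0 l)"
proof -
  have "D b l = (\<lambda>x. b + x) ` D 0 l"
  proof (intro equalityI subsetI)
    fix x assume "x \<in> D b l"
    then show "x \<in> (\<lambda>x. b + x) ` D 0 l" by (intro image_eqI[of _ _ "x - b"]) (auto simp: in_D)
  qed (auto simp: in_D)
  then show ?thesis using emeasure_translate D_sets by simp
qed

text \<open>Measurability is asked of the pieces only, so it spreads from small disks to large ones
  along with the measure.\<close>

lemma emeasure_children:
  assumes "\<And>c. c \<in> C \<Longrightarrow> E \<inter> D (child b l c) (l - 1) \<in> sets M"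
  shows "E \<inter> D b l \<in> sets M"
    and "emeasure M (E \<inter> D b l) = (\<Sum>c\<in>C. emeasure M (E \<inter> D (child b l c) (l - 1)))"
proof -
  have eq: "E \<inter> D b l = (\<Union>c\<in>C. E \<inter> D (child b l c) (l - 1))"
    unfolding D_split[of b l] by blast
  show "E \<inter> D b l \<in> sets M" unfolding eq using assms finite_C by (intro sets.finite_UN) auto
  have "disjoint_family_on (\<lambda>c. E \<inter> D (child b l c) (l - 1)) C"
    using disjoint_children[of b l] by (auto simp: disjoint_family_on_def)
  then show "emeasure M (E \<inter> D b l) = (\<Sum>c\<in>C. emeasure M (E \<inter> D (child b l c) (l - 1)))"
    unfolding eq using assms finite_C by (intro sum_emeasure[symmetric]) auto
qed

text \<open>The \<open>q\<close> children are disjoint translates of each other, so each level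
  contributes a factor \<open>q\<close>. The unit disk fixes the normalization, and the induction
  runs from it in both directions.\<close>

lemma emeasure_D: "emeasure M (D b l) = ennreal (real q powr of_int l)"
proof -
  have step: "emeasure M (D 0 l) = ennreal (real q) * emeasure M (D 0 (l - 1))" for l
    using emeasure_children(2)[of UNIV 0 l] card_C
    by (simp add: emeasure_D_translate[of "child 0 l _"] ennreal_of_nat_eq_real_of_nat)
  have pow: "ennreal (real q powr of_int l) = ennreal (real q) * ennreal (real q powr of_int (l - 1))" for l
    using q_gt_1 by (simp add: powr_diff flip: ennreal_mult)
  have "emeasure M (D 0 l) = ennreal (real q powr of_int l)"
  proof (induction l rule: int_induct[where k = 0])
    case base
    then show ?case using q_gt_1 emeasure_unit by (simp add: D_def)
  next
    case (step1 i)
    then show ?case using step[of "i + 1"] pow[of "i + 1"] by simp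
  next
    case (step2 i)
    then show ?case using step[of i] pow[of i] q_gt_1 by (simp add: ennreal_mult_cancel_left)
  qed
  then show ?thesis using emeasure_D_translate by metis
qed

lemma measure_D: "measure M (D b l) = real q powr of_int l"
  by (simp add: measure_def emeasure_D)

lemma D_fmeasurable: "D b l \<in> fmeasurable M"
  by (simp add: fmeasurable_def emeasure_D)

text \<open>Relative measure \<open>p\<close> in every child gives relative measure \<open>p\<close>
  in the parent. The bound \<open>l \<le> k\<close> keeps the children inside \<open>D a k\<close>,
  where the base case is available.\<close>

lemma proportion_mono:
  assumes "p \<ge> 0" "l0 \<le> l" "l \<le> k" "b \<in> D a k"
    and base: "\<And>b. b \<in> D a k \<Longrightarrow> E \<inter> D b l0 \<in> sets M \<and> emeasure M (E \<inter> D b l0) = ennreal (p * real q powr of_int l0)"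
  shows "E \<inter> D b l \<in> sets M \<and> emeasure M (E \<inter> D b l) = ennreal (p * real q powr of_int l)"
  using \<open>l0 \<le> l\<close> \<open>l \<le> k\<close> \<open>b \<in> D a k\<close>
proof (induction l arbitrary: b rule: int_ge_induct)
  case base
  then show ?case using assms(5) by blast
next
  case (step l)
  have ch: "child b (l + 1) c \<in> D a k" if "c \<in> C" for c
    using child_in_D[OF that] D_subset[OF step.prems(2,1)] by blast
  have IH: "E \<inter> D (child b (l + 1) c) l \<in> sets M"
    "emeasure M (E \<inter> D (child b (l + 1) c) l) = ennreal (p * real q powr of_int l)" if "c \<in> C" for c
    using step.IH[OF _ ch[OF that]] step.prems by auto
  have "emeasure M (E \<inter> D b (l + 1)) = (\<Sum>c\<in>C. ennreal (p * real q powr of_int l))"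
    using emeasure_children(2)[of E b "l + 1"] IH by simp
  also have "\<dots> = ennreal (p * real q powr of_int (l + 1))"
    using card_C q_gt_1 assms(1)
    by (simp add: ennreal_of_nat_eq_real_of_nat powr_add mult_ac flip: ennreal_mult)
  finally show ?case using emeasure_children(1)[of E b "l + 1"] IH by simp
qed

section \<open>Visits to a disk and their independence\<close>

definition hits :: "'a set \<Rightarrow> ('a \<Rightarrow> 'a) \<Rightarrow> 'a \<Rightarrow> nat \<Rightarrow> 'a set" where
  "hits \<Omega> f c j = {x \<in> \<Omega>. intpart av prm C (f x) \<in> D c (- int j)}"

text \<open>In a disk of radius \<open>q^-lam\<close> the visits form a single disk of radius
  \<open>q^(-lam-j)\<close>, hence a fraction \<open>q^-j\<close>; larger disks inherit this by
  \<open>proportion_mono\<close>.\<close>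

lemma hits_proportion:
  assumes f: "scaling av q (D a k) f lam" and c: "av c \<le> 1"
    and l: "- lam \<le> l" "l \<le> k" and b: "b \<in> D a k"
  shows "hits (D a k) f c j \<inter> D b l \<in> sets M"
    and "emeasure M (hits (D a k) f c j \<inter> D b l) = ennreal (real q powr - real j * real q powr of_int l)"
proof -
  have "hits (D a k) f c j \<inter> D b (- lam) \<in> sets M \<and>
     emeasure M (hits (D a k) f c j \<inter> D b (- lam)) = ennreal (real q powr - real j * real q powr of_int (- lam))"
    if "b \<in> D a k" for b
  proof -
    have sub: "D b (- lam) \<subseteq> D a k" using D_subset l that by simp
    from intpart_scaling_preimage[OF f sub c, of j] sub
    obtain x where "hits (D a k) f c j \<inter> D b (- lam) = D x (- lam - int j)"
      unfolding hits_def by blast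
    then show ?thesis by (simp add: emeasure_D algebra_simps flip: powr_add)
  qed
  from proportion_mono[OF _ l b this]
  show "hits (D a k) f c j \<inter> D b l \<in> sets M"
    and "emeasure M (hits (D a k) f c j \<inter> D b l) = ennreal (real q powr - real j * real q powr of_int l)"
    by auto
qed

text \<open>Inside a disk of radius \<open>q^-lam\<close> the first set is one disk of radius
  \<open>q^(-lam-j)\<close>. The gap \<open>j\<close> between the exponents makes this radius at
  least \<open>q^-lam'\<close>, so the second set takes up the fraction \<open>q^-j\<close> of
  it.\<close>

lemma hits_indep:
  assumes f: "scaling av q (D a k) f lam" and g: "scaling av q (D a k) g lam'" and c: "av c \<le> 1"
    and l: "- lam \<le> k" "lam' \<ge> lam + int j"
  shows "emeasure M (hits (D a k) f c j \<inter> hits (D a k) g c j)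
    = ennreal (real q powr - real j * real q powr - real j * real q powr of_int k)"
proof -
  let ?E = "hits (D a k) f c j" and ?F = "hits (D a k) g c j"
  have "?E \<inter> ?F \<inter> D b (- lam) \<in> sets M \<and>
     emeasure M (?E \<inter> ?F \<inter> D b (- lam)) = ennreal ((real q powr - real j * real q powr - real j) * real q powr of_int (- lam))"
    if "b \<in> D a k" for b
  proof -
    have sub: "D b (- lam) \<subseteq> D a k" using D_subset l that by simp
    from intpart_scaling_preimage[OF f sub c, of j] sub
    obtain x where x: "x \<in> D b (- lam)" "?E \<inter> D b (- lam) = D x (- lam - int j)"
      unfolding hits_def by blast
    then have "?E \<inter> ?F \<inter> D b (- lam) = ?F \<inter> D x (- lam - int j)" by blast
    then show ?thesis
      using hits_proportion[OF g c, of "- lam - int j" x j] l x sub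
      by (auto simp: mult.assoc simp flip: powr_add)
  qed
  from proportion_mono[OF _ l(1) order_refl center_in_D this]
  have "emeasure M (?E \<inter> ?F \<inter> D a k) = ennreal (real q powr - real j * real q powr - real j * real q powr of_int k)" by simp
  moreover have "?E \<inter> ?F \<inter> D a k = ?E \<inter> ?F" by (auto simp: hits_def)
  ultimately show ?thesis by simp
qed

lemma hits_measure:
  assumes f: "scaling av q (D a k) f lam" and c: "av c \<le> 1" and l: "- lam \<le> k"
  shows "hits (D a k) f c j \<in> sets M"
    and "measure M (hits (D a k) f c j) = real q powr - real j * real q powr of_int k"
proof -
  have "hits (D a k) f c j \<inter> D a k = hits (D a k) f c j" by (auto simp: hits_def)
  then show "hits (D a k) f c j \<in> sets M"
    and "measure M (hits (D a k) f c j) = real q powr - real j * real q powr of_int k"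
    using hits_proportion[OF f c l order_refl center_in_D, of j] by (simp_all add: measure_def)
qed

section \<open>Variance and almost sure frequencies\<close>

text \<open>The centred indicator of a visit. The factor \<open>indicator \<Omega> x\<close>
  confines it to \<open>\<Omega>\<close>, which keeps it integrable for a disk
  \<open>\<Omega>\<close> although the whole field has infinite measure.\<close>

definition discrepancy :: "'a set \<Rightarrow> ('a \<Rightarrow> 'a) \<Rightarrow> 'a \<Rightarrow> nat \<Rightarrow> 'a \<Rightarrow> real" where
  "discrepancy \<Omega> f c j x = indicator (hits \<Omega> f c j) x - real q powr - real j * indicator \<Omega> x"

lemma discrepancy_le_1: "\<bar>discrepancy \<Omega> f c j x\<bar> \<le> 1"
proof -
  have "real q powr - real j \<le> 1" using powr_mono[of "- real j" 0 "real q"] q_gt_1 by simp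
  moreover have "real q powr - real j \<ge> 0" by simp
  ultimately show ?thesis unfolding discrepancy_def
    by (auto simp: hits_def indicator_def)
qed

text \<open>Exponents at distance at least \<open>j\<close> give independent visits and covariance
  0; the other pairs are bounded crudely by the measure \<open>q^k\<close> of the disk.\<close>

lemma correlation:
  assumes f: "scaling av q (D a k) f lam" and g: "scaling av q (D a k) g lam'" and c: "av c \<le> 1"
    and l: "- lam \<le> k" "- lam' \<le> k"
  shows "integrable M (\<lambda>x. discrepancy (D a k) f c j x * discrepancy (D a k) g c j x)"
    and "(\<integral>x. discrepancy (D a k) f c j x * discrepancy (D a k) g c j x \<partial>M)
      \<le> real q powr of_int k * of_bool (\<bar>lam - lam'\<bar> < int j)"
proof -
  let ?E = "hits (D a k) f c j" and ?F = "hits (D a k) g c j" and ?p = "real q powr - real j"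
  note E = hits_measure[OF f c l(1), of j] and F = hits_measure[OF g c l(2), of j]
  have sub: "?E \<subseteq> D a k" "?F \<subseteq> D a k" by (auto simp: hits_def)
  have EF: "?E \<in> fmeasurable M" "?F \<in> fmeasurable M" "?E \<inter> ?F \<in> fmeasurable M"
    by (rule fmeasurableI2[OF D_fmeasurable[of a k]]; use sub E(1) F(1) in blast)+
  have int: "integrable M (indicator A :: 'a \<Rightarrow> real)" if "A \<in> fmeasurable M" for A
    using that by (simp add: fmeasurable_def)
  have eq: "discrepancy (D a k) f c j x * discrepancy (D a k) g c j x
      = indicator (?E \<inter> ?F) x - ?p * indicator ?E x - ?p * indicator ?F x + ?p * ?p * indicator (D a k) x" for x
    using sub unfolding discrepancy_def by (auto simp: indicator_def algebra_simps)
  note [simp] = int[OF EF(1)] int[OF EF(2)] int[OF EF(3)] int[OF D_fmeasurable]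
  show "integrable M (\<lambda>x. discrepancy (D a k) f c j x * discrepancy (D a k) g c j x)"
    unfolding eq by simp
  \<comment> \<open>Each of the two linear terms contributes \<open>- ?p^2 * q^k\<close> and the
    last term \<open>+ ?p^2 * q^k\<close>.\<close>
  have val: "(\<integral>x. discrepancy (D a k) f c j x * discrepancy (D a k) g c j x \<partial>M)
      = measure M (?E \<inter> ?F) - ?p * ?p * real q powr of_int k"
    unfolding eq using E F by (simp add: measure_D)
  show "(\<integral>x. discrepancy (D a k) f c j x * discrepancy (D a k) g c j x \<partial>M)
      \<le> real q powr of_int k * of_bool (\<bar>lam - lam'\<bar> < int j)"
  proof (cases "\<bar>lam - lam'\<bar> < int j")
    case True
    have "measure M (?E \<inter> ?F) \<le> measure M (D a k)"
      using sub E(1) F(1) D_fmeasurable by (intro measure_mono_fmeasurable) auto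
    then have "measure M (?E \<inter> ?F) \<le> real q powr of_int k" by (simp add: measure_D)
    moreover have "0 \<le> ?p * ?p * real q powr of_int k" by (intro mult_nonneg_nonneg) auto
    ultimately have "measure M (?E \<inter> ?F) - ?p * ?p * real q powr of_int k \<le> real q powr of_int k" by linarith
    then show ?thesis unfolding val using True by simp
  next
    case False
    then consider "lam' \<ge> lam + int j" | "lam \<ge> lam' + int j" by linarith
    then have "emeasure M (?E \<inter> ?F) = ennreal (?p * ?p * real q powr of_int k)"
      using hits_indep[OF f g c l(1)] hits_indep[OF g f c l(2)] by cases (simp_all add: Int_commute)
    then show ?thesis using False val by (simp add: measure_def)
  qed
qed

lemma AE_hits_frequency:
  assumes f: "\<And>n. n \<ge> 1 \<Longrightarrow> scaling av q (D a k) (f n) (lam n)" and c: "av c \<le> 1"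
    and l: "\<And>n. n \<ge> 1 \<Longrightarrow> - lam n \<le> k"
    and B: "summable (\<lambda>N. real (card {(n, m). n \<in> {1..N} \<and> m \<in> {1..N} \<and> lam n = lam m}) / real N ^ 3)"
  shows "AE x in M. x \<in> D a k \<longrightarrow>
    (\<lambda>N. real (card {n \<in> {1..N}. intpart av prm C (f n x) \<in> D c (- int j)}) / real N)
      \<longlonglongrightarrow> real q powr - real j"
proof -
  define Y where "Y n = discrepancy (D a k) (f n) c j" for n
  define G where "G N x = (\<Sum>n=1..N. Y n x)\<^sup>2 / real N ^ 3" for N x
  define b where "b N = real (card {(n, m). n \<in> {1..N} \<and> m \<in> {1..N} \<and> lam n = lam m}) / real N ^ 3" for N
  \<comment> \<open>\<open>q^k\<close> bounds a single covariance, and \<open>2 * j\<close> is the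
    price for replacing pairs of near exponents by pairs of equal ones.\<close>
  define K where "K = real q powr of_int k * (2 * real j)"
  have YY: "integrable M (\<lambda>x. Y n x * Y m x)"
    "(\<integral>x. Y n x * Y m x \<partial>M) \<le> real q powr of_int k * of_bool (\<bar>lam n - lam m\<bar> < int j)"
    if "n \<ge> 1" "m \<ge> 1" for n m
    unfolding Y_def using correlation[OF f f c l l] that by auto
  have G_eq: "G N x = (\<Sum>n=1..N. \<Sum>m=1..N. Y n x * Y m x) / real N ^ 3" for N x
    by (simp add: G_def power2_eq_square sum_product)
  have int_G: "integrable M (G N)" for N
    unfolding G_eq[abs_def] using YY by (intro integrable_divide_zero Bochner_Integration.integrable_sum) auto
  have G_nonneg: "G N x \<ge> 0" for N x by (simp add: G_def)
  have G_le: "(\<integral>x. G N x \<partial>M) \<le> K * b N" for N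
  proof -
    have "(\<integral>x. G N x \<partial>M) = (\<Sum>n=1..N. \<Sum>m=1..N. \<integral>x. Y n x * Y m x \<partial>M) / real N ^ 3"
    proof -
      have "(\<integral>x. (\<Sum>n=1..N. \<Sum>m=1..N. Y n x * Y m x) \<partial>M) = (\<Sum>n=1..N. \<integral>x. (\<Sum>m=1..N. Y n x * Y m x) \<partial>M)"
        using YY(1) by (intro Bochner_Integration.integral_sum Bochner_Integration.integrable_sum) auto
      also have "\<dots> = (\<Sum>n=1..N. \<Sum>m=1..N. \<integral>x. Y n x * Y m x \<partial>M)"
        using YY(1) by (intro sum.cong refl Bochner_Integration.integral_sum) auto
      finally show ?thesis unfolding G_eq by simp
    qed
    also have "\<dots> \<le> (\<Sum>n=1..N. \<Sum>m=1..N. real q powr of_int k * of_bool (\<bar>lam n - lam m\<bar> < int j)) / real N ^ 3"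
      by (intro divide_right_mono sum_mono YY(2)) auto
    also have "(\<Sum>n=1..N. \<Sum>m=1..N. real q powr of_int k * of_bool (\<bar>lam n - lam m\<bar> < int j))
        = real q powr of_int k * (\<Sum>(n, m)\<in>{1..N} \<times> {1..N}. of_bool (\<bar>lam n - lam m\<bar> < int j))"
      by (simp only: sum.cartesian_product sum_distrib_left[symmetric])
    also have "(\<Sum>(n, m)\<in>{1..N} \<times> {1..N}. of_bool (\<bar>lam n - lam m\<bar> < int j))
        = real (card {(n, m). n \<in> {1..N} \<and> m \<in> {1..N} \<and> \<bar>lam n - lam m\<bar> < int j})"
      by (simp add: case_prod_unfold Int_def) (rule arg_cong[where f = card], auto)
    also have "real q powr of_int k * \<dots> / real N ^ 3
        \<le> real q powr of_int k * (real (2 * j * card {(n, m). n \<in> {1..N} \<and> m \<in> {1..N} \<and> lam n = lam m})) / real N ^ 3"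
      using card_near_pairs_le[of "{1..N}" lam j]
      by (intro divide_right_mono mult_left_mono of_nat_mono) auto
    also have "\<dots> = K * b N" by (simp add: K_def b_def)
    finally show ?thesis .
  qed
  have "(\<integral>\<^sup>+x. (\<Sum>N. ennreal (G N x)) \<partial>M) = (\<Sum>N. \<integral>\<^sup>+x. ennreal (G N x) \<partial>M)"
    using borel_measurable_integrable[OF int_G] by (intro nn_integral_suminf) auto
  also have "\<dots> = (\<Sum>N. ennreal (\<integral>x. G N x \<partial>M))"
    using int_G G_nonneg by (simp add: nn_integral_eq_integral)
  also have "\<dots> \<le> (\<Sum>N. ennreal (K * b N))"
    by (intro suminf_le summableI ennreal_leI G_le)
  also have "\<dots> < \<infinity>"
  proof -
    have "summable (\<lambda>N. K * b N)" unfolding b_def by (intro summable_mult B)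
    moreover have "0 \<le> K * b N" for N by (simp add: K_def b_def)
    ultimately show ?thesis using ennreal_suminf_neq_top by (simp add: less_top)
  qed
  \<comment> \<open>A nonnegative series with finite integral is finite almost everywhere.\<close>
  finally have "AE x in M. (\<Sum>N. ennreal (G N x)) \<noteq> \<infinity>"
    using borel_measurable_integrable[OF int_G] by (intro nn_integral_PInf_AE) auto
  then show ?thesis
  proof (rule AE_mp, intro AE_I2 impI)
    fix x assume fin: "(\<Sum>N. ennreal (G N x)) \<noteq> \<infinity>" and x: "x \<in> D a k"
    have "summable (\<lambda>N. G N x)"
      using fin by (intro summable_suminf_not_top G_nonneg) auto
    then have "(\<lambda>N. (\<Sum>n=1..N. Y n x) / real N) \<longlonglongrightarrow> 0"
      unfolding G_def by (intro averages_tendsto_0) (simp_all add: Y_def discrepancy_le_1)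
    then have lim: "(\<lambda>N. (\<Sum>n=1..N. Y n x) / real N + real q powr - real j) \<longlonglongrightarrow> real q powr - real j"
      using tendsto_add[OF _ tendsto_const] by fastforce
    \<comment> \<open>The restriction \<open>N \<ge> 1\<close> matters: at \<open>N = 0\<close>
      division by zero leaves \<open>q^-j\<close> on the left and 0 on the right.\<close>
    have "(\<Sum>n=1..N. Y n x) / real N + real q powr - real j
        = real (card {n \<in> {1..N}. intpart av prm C (f n x) \<in> D c (- int j)}) / real N" if "N \<ge> 1" for N
    proof -
      have "(\<Sum>n=1..N. Y n x) = (\<Sum>n=1..N. of_bool (intpart av prm C (f n x) \<in> D c (- int j)) - real q powr - real j)"
        using x by (intro sum.cong) (auto simp: Y_def discrepancy_def hits_def)
      also have "\<dots> = real (card {n \<in> {1..N}. intpart av prm C (f n x) \<in> D c (- int j)}) - real N * real q powr - real j"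
        by (simp add: sum_subtractf Int_def)
      finally show ?thesis using that by (simp add: field_simps)
    qed
    then show "(\<lambda>N. real (card {n \<in> {1..N}. intpart av prm C (f n x) \<in> D c (- int j)}) / real N)
      \<longlonglongrightarrow> real q powr - real j"
      using lim by (rule Lim_transform_eventually[OF _ eventually_sequentiallyI[of 1], rotated]) auto
  qed
qed

end

section \<open>Uniform distribution almost everywhere\<close>

theorem theorem1p2:
  fixes av :: "'a::field \<Rightarrow> real" and q :: nat and prm :: 'a and C :: "'a set"
    and M :: "'a measure" and \<Omega> :: "'a set" and a :: 'a and k :: int
    and f :: "nat \<Rightarrow> 'a \<Rightarrow> 'a" and lam :: "nat \<Rightarrow> int"
  assumes F: "nonarch_local_field av q prm C"
    and H: "haar_measure av q M"
    and disk: "\<Omega> = disk av a (real q powr k)"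
    and scal: "\<forall>n\<ge>1. scaling av q \<Omega> (f n) (lam n)"
    and A: "\<forall>n\<ge>1. real q powr (lam n) \<ge> inverse (real q powr k)"
    and B: "summable (\<lambda>N. real (card {(n, m). n \<in> {1..N} \<and> m \<in> {1..N} \<and> lam n = lam m})
                          / real N ^ 3)"
  shows "AE x in M. x \<in> \<Omega> \<longrightarrow> unif_distr av q (\<lambda>n. intpart av prm C (f n x))"
proof -
  interpret local_field_haar av q prm C M by unfold_locales (fact F H)+
  have \<Omega>: "\<Omega> = D a k" by (simp add: disk D_def)
  \<comment> \<open>Hypothesis (a) in terms of exponents: disks of radius \<open>q^-(lam n)\<close>
    about points of \<open>\<Omega>\<close> fit into \<open>\<Omega>\<close>.\<close>
  have l: "- lam n \<le> k" if "n \<ge> 1" for n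
  proof -
    have "real q powr of_int (- k) \<le> real q powr of_int (lam n)"
      using A that by (simp add: powr_minus)
    then show ?thesis using q_gt_1 by simp
  qed
  obtain R where R: "\<And>j. finite (R j)" "\<And>j. R j \<subseteq> D 0 0" "\<And>j x. x \<in> D 0 0 \<Longrightarrow> \<exists>b\<in>R j. x \<in> D b (- int j)"
    using finite_net by metis
  have unit: "x \<in> D 0 0 \<longleftrightarrow> av x \<le> 1" for x using q_gt_1 by (simp add: in_D)
  \<comment> \<open>Only countably many pairs of \<open>j\<close> and \<open>c\<close> occur, so the
    exceptional null sets can be united.\<close>
  have "AE x in M. \<forall>j. \<forall>c\<in>R j. x \<in> D a k \<longrightarrow>
    (\<lambda>N. real (card {n \<in> {1..N}. intpart av prm C (f n x) \<in> D c (- int j)}) / real N)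
      \<longlonglongrightarrow> real q powr - real j"
  proof (rule AE_all_countable[THEN iffD2], rule allI, rule AE_finite_allI[OF R(1)])
    fix j c assume "c \<in> R j"
    then have c: "av c \<le> 1" using R(2) unit by blast
    then show "AE x in M. x \<in> D a k \<longrightarrow>
      (\<lambda>N. real (card {n \<in> {1..N}. intpart av prm C (f n x) \<in> D c (- int j)}) / real N)
        \<longlonglongrightarrow> real q powr - real j"
      using scal unfolding \<Omega> by (intro AE_hits_frequency[where lam = lam] c l B) auto
  qed
  then show ?thesis
  proof (rule AE_mp, intro AE_I2 impI)
    fix x
    assume lim: "\<forall>j. \<forall>c\<in>R j. x \<in> D a k \<longrightarrow>
      (\<lambda>N. real (card {n \<in> {1..N}. intpart av prm C (f n x) \<in> D c (- int j)}) / real N)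
        \<longlonglongrightarrow> real q powr - real j" and "x \<in> \<Omega>"
    have "(\<lambda>N. real (card {n \<in> {1..N}. intpart av prm C (f n x) \<in> disk av c (real q powr - real j)}) / real N)
        \<longlonglongrightarrow> real q powr - real j" if "av c \<le> 1" for c j
    proof -
      have "c \<in> D 0 0" using that unit by blast
      \<comment> \<open>Each disk of radius \<open>q^-j\<close> centred in the unit disk is one of
        those about \<open>R j\<close>, since \<open>c\<close> is also a centre of the disk about
        \<open>b\<close>.\<close>
      then obtain b where b: "b \<in> R j" "c \<in> D b (- int j)" using R(3)[of c j] by blast
      have "disk av c (real q powr - real j) = D b (- int j)"
        using D_eq[OF b(2)] by (simp add: D_def)
      then show ?thesis using lim b(1) \<open>x \<in> \<Omega>\<close> \<Omega> by simp
    qed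
    then show "unif_distr av q (\<lambda>n. intpart av prm C (f n x))"
      unfolding unif_distr_def by (simp add: av_intpart_le)
  qed
qed

end
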